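(* Let $m\ge n$, $p+q=m$, $A\in\mathbb{R}^{m\times n}$, $b\in\mathbb{R}^m$, $B\in\mathbb{R}^{s\times n}$, $d\in\mathbb{R}^s$, $y\in\mathbb{R}^n$, and let $\theta_1,\theta_2,\theta_3>0$. Put $r_y=b-Ay$ and assume $r_y\ne0$. Let $\mu_{\tt ILSE}$, $\tau_0$ and $\rho$ be the normwise backward error of $y$, the constant, and the linearized estimate defined in the context. If $$4\tau_0\,\rho\,\sqrt{\theta_1^{-2}+\|y\|_2^2}<1,$$ then $$\frac{2\rho}{1+\sqrt2}\ \le\ \mu_{\tt ILSE}\ \le\ 2\rho .$$
   Context: Background: the equality constrained indefinite least squares problem (ILSE) is $\min_x (b-Ax)^\top\Sigma_{pq}(b-Ax)$ subject to $Bx=d$, where $\Sigma_{pq}=\begin{pmatrix}I_p&0\\0&-I_q\end{pmatrix}$, $p+q=m$. The vector $y$ is regarded as a computed solution. Notation: $\|\cdot\|_F$ is the Frobenius norm, $\|\cdot\|_2$ the spectral norm of a matrix or 2-norm of a vector, $M^\dagger$ the Moore-Penrose inverse, $\mathrm{vec}(M)$ stacks the columns of $M$, $\otimes$ is the Kronecker product. Perturbation set: $S_{\tt ILSE}(y)$ is the set of all $(E,f,F,g)\in\mathbb{R}^{m\times n}\times\mathbb{R}^m\times\mathbb{R}^{s\times n}\times\mathbb{R}^s$ for which there exists $\xi\in\mathbb{R}^s$ (a vector of Lagrange multipliers) with $$(A+E)^\top\Sigma_{pq}\bigl(b+f-(A+E)y\bigr)=(B+F)^\top\xi,\qquad (B+F)y=d+g.$$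 Normwise backward error: $$\mu_{\tt ILSE}=\inf_{(E,f,F,g)\in S_{\tt ILSE}(y)}\left\|\begin{bmatrix}E&\theta_1 f\\ \theta_2F&\theta_3 g\end{bmatrix}\right\|_F .$$ For $\xi\in\mathbb{R}^s$ let $$J(\xi)=\begin{bmatrix}I_n\otimes(r_y^\top\Sigma_{pq})-A^\top\Sigma_{pq}(y^\top\otimes I_m)&\theta_1^{-1}A^\top\Sigma_{pq}&-\theta_2^{-1}(I_n\otimes\xi^\top)&0\\0&0&\theta_2^{-1}(y^\top\otimes I_s)&-\theta_3^{-1}I_s\end{bmatrix},$$ $$\rho(\xi)=\left\|J(\xi)^\dagger\begin{bmatrix}B^\top\xi-A^\top\Sigma_{pq}r_y\\ d-By\end{bmatrix}\right\|_2,\qquad \rho=\inf_{\xi\in\mathbb{R}^s}\rho(\xi),$$ $$\tau_0=\left\|\begin{bmatrix}I_n\otimes(r_y^\top\Sigma_{pq})-A^\top\Sigma_{pq}(y^\top\otimes I_m)&\theta_1^{-1}A^\top\Sigma_{pq}&0\\0&0&-\theta_3^{-1}I_s\end{bmatrix}^\dagger\right\|_2 .$$ *)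

theory Defs
  imports "HOL-Analysis.Analysis"
begin

section \<open>Matrix norms, Kronecker products and block matrices\<close>

definition frobenius_norm :: "real^'n^'m \<Rightarrow> real" where
  "frobenius_norm M = sqrt (\<Sum>i\<in>UNIV. \<Sum>j\<in>UNIV. (M $ i $ j)\<^sup>2)"

lemma frobenius_norm_eq_norm: "frobenius_norm M = norm M"
  by (simp add: frobenius_norm_def norm_vec_def L2_set_def sum_nonneg)

definition spectral_norm :: "real^'n^'m \<Rightarrow> real" where
  "spectral_norm M = onorm ((*v) M)"

definition kronecker :: "real^'b^'a \<Rightarrow> real^'d^'c \<Rightarrow> real^('b \<times> 'd)^('a \<times> 'c)" where
  "kronecker M N = (\<chi> i j. M $ fst i $ fst j * N $ snd i $ snd j)"

text \<open>The column stacking vec(M) of a matrix with rows \<open>'m\<close> and columns \<open>'n\<close> is indexed by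
  pairs (column, row), i.e. by \<open>'n \<times> 'm\<close>; this is the order in which \<open>kronecker\<close> indexes.
  The following two operations identify the row indices \<open>'a \<times> 1\<close> and \<open>1 \<times> 'a\<close> of a Kronecker
  product having a one-row factor with \<open>'a\<close>.\<close>

definition drop_unit_snd :: "real^'c^('a \<times> 1) \<Rightarrow> real^'c^'a" where
  "drop_unit_snd M = (\<chi> i. M $ (i, 1))"

definition drop_unit_fst :: "real^'c^(1 \<times> 'a) \<Rightarrow> real^'c^'a" where
  "drop_unit_fst M = (\<chi> i. M $ (1, i))"

definition hcat :: "real^'a^'r \<Rightarrow> real^'b^'r \<Rightarrow> real^('a + 'b)^'r" (infixr "|||" 65) where
  "M ||| N = (\<chi> i j. case j of Inl a \<Rightarrow> M $ i $ a | Inr b \<Rightarrow> N $ i $ b)"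

text \<open>Stacks two matrices (\<open>'c\<close> a type of rows) or two vectors (\<open>'c\<close> the reals).\<close>

definition vcat :: "'c^'r \<Rightarrow> 'c^'s \<Rightarrow> 'c^('r + 's)" (infixr "'/'/'/" 60) where
  "M /// N = (\<chi> i. case i of Inl a \<Rightarrow> M $ a | Inr b \<Rightarrow> N $ b)"

section \<open>The Moore-Penrose inverse\<close>

definition is_pinv :: "real^'n^'m \<Rightarrow> real^'m^'n \<Rightarrow> bool" where
  "is_pinv M X \<longleftrightarrow>
     M ** X ** M = M \<and> X ** M ** X = X \<and>
     transpose (M ** X) = M ** X \<and> transpose (X ** M) = X ** M"

definition pinv :: "real^'n^'m \<Rightarrow> real^'m^'n" where
  "pinv M = (THE X. is_pinv M X)"

lemma is_pinv_unique:
  assumes X: "is_pinv M X" and Y: "is_pinv M Y"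
  shows "X = Y"
proof -
  have a: "M ** X = M ** Y"
  proof -
    have "M ** X = (M ** Y) ** (M ** X)"
      using Y by (simp add: is_pinv_def matrix_mul_assoc)
    then have "transpose (M ** X) = transpose ((M ** Y) ** (M ** X))" by simp
    also have "\<dots> = (M ** X) ** (M ** Y)"
      using X Y by (simp add: is_pinv_def matrix_transpose_mul[of "M ** Y" "M ** X"])
    also have "\<dots> = M ** Y"
      using X by (simp add: is_pinv_def matrix_mul_assoc)
    finally show ?thesis using X by (simp add: is_pinv_def)
  qed
  have b: "X ** M = Y ** M"
  proof -
    have "X ** M = (X ** M) ** (Y ** M)"
      using Y by (metis is_pinv_def matrix_mul_assoc)
    then have "transpose (X ** M) = transpose ((X ** M) ** (Y ** M))" by simp
    also have "\<dots> = (Y ** M) ** (X ** M)"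
      using X Y by (simp add: is_pinv_def matrix_transpose_mul[of "X ** M" "Y ** M"])
    also have "\<dots> = Y ** M"
      using X by (metis is_pinv_def matrix_mul_assoc)
    finally show ?thesis using X by (simp add: is_pinv_def)
  qed
  have "X = X ** (M ** X)" using X by (simp add: is_pinv_def matrix_mul_assoc)
  also have "\<dots> = (X ** M) ** Y" by (simp add: a matrix_mul_assoc)
  also have "\<dots> = Y" using Y by (simp add: b is_pinv_def)
  finally show ?thesis .
qed

lemma is_pinv_exists: "\<exists>X. is_pinv (M :: real^'n^'m) X"
proof -
  let ?R = "range ((*v) M)" and ?S = "span (rows M)"
  have subR: "subspace ?R"
    by (intro linear_subspace_image matrix_vector_mul_linear subspace_UNIV)
  have null: "M *v k = 0" if "\<And>w. w \<in> ?S \<Longrightarrow> orthogonal k w" for k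
  proof -
    have "row i M \<bullet> k = 0" for i
      using that[OF span_base, of "row i M"]
      by (auto simp: rows_def orthogonal_def inner_commute)
    then show ?thesis
      by (simp add: vec_eq_iff matrix_vector_mult_def row_def inner_vec_def)
  qed
  have ex: "\<exists>x. x \<in> ?S \<and> (\<forall>u. (b - M *v x) \<bullet> (M *v u) = 0)" for b
  proof -
    obtain v w where v: "v \<in> span ?R" and w: "\<And>u. u \<in> span ?R \<Longrightarrow> orthogonal w u"
      and b: "b = v + w"
      using orthogonal_subspace_decomp_exists[of ?R b] by metis
    obtain z where z: "v = M *v z"
      using v subR by (auto simp: span_eq_iff[THEN iffD2])
    obtain x k where x: "x \<in> span ?S" and k: "\<And>u. u \<in> span ?S \<Longrightarrow> orthogonal k u"
      and zx: "z = x + k"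
      using orthogonal_subspace_decomp_exists[of ?S z] by metis
    have "M *v k = 0" using k by (intro null) (simp add: span_span)
    then have "b - M *v x = w" using b z zx by (simp add: matrix_vector_right_distrib)
    then show ?thesis
      using x w by (intro exI[of _ x]) (auto simp: span_span orthogonal_def span_base)
  qed
  then obtain g where gS: "\<And>b. g b \<in> ?S" and gO: "\<And>b u. (b - M *v g b) \<bullet> (M *v u) = 0"
    by metis
  have uniq: "x = g b" if "x \<in> ?S" "\<And>u. (b - M *v x) \<bullet> (M *v u) = 0" for x b
  proof -
    have e: "M *v (x - g b) = (b - M *v g b) - (b - M *v x)"
      by (simp add: matrix_vector_mult_diff_distrib)
    have "(M *v (x - g b)) \<bullet> (M *v (x - g b)) = 0"
      unfolding arg_cong[OF e, of "\<lambda>v. v \<bullet> (M *v (x - g b))"]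
      by (simp only: inner_diff_left[of "b - M *v g b"] that gO diff_self)
    then have "M *v (x - g b) = 0" by simp
    moreover have "x - g b \<in> ?S" using that gS by (simp add: span_diff)
    ultimately have "x - g b = 0" using nullspace_inter_rowspace by blast
    then show ?thesis by simp
  qed
  have lin: "linear g"
  proof (rule linearI)
    fix a b c
    show "g (a + b) = g a + g b"
    proof (rule sym, rule uniq)
      show "g a + g b \<in> ?S" using gS by (simp add: span_add)
      have e: "a + b - M *v (g a + g b) = (a - M *v g a) + (b - M *v g b)"
        by (simp add: matrix_vector_right_distrib)
      show "(a + b - M *v (g a + g b)) \<bullet> (M *v u) = 0" for u
        by (simp only: e inner_add_left gO)
    qed
    show "g (c *\<^sub>R b) = c *\<^sub>R g b"
    proof (rule sym, rule uniq)
      show "c *\<^sub>R g b \<in> ?S" using gS by (simp add: span_mul)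
      have e: "c *\<^sub>R b - M *v (c *\<^sub>R g b) = c *\<^sub>R (b - M *v g b)"
        by (simp add: matrix_vector_mult_scaleR scaleR_right_diff_distrib)
      show "(c *\<^sub>R b - M *v (c *\<^sub>R g b)) \<bullet> (M *v u) = 0" for u
        by (simp only: e inner_scaleR_left gO)
    qed
  qed
  let ?X = "matrix g"
  have X: "?X *v b = g b" for b using lin by (simp add: matrix_works linear_matrix_vector_mul_eq)
  have MXM: "M *v g (M *v x) = M *v x" for x
  proof -
    have e: "M *v x - M *v g (M *v x) = M *v (x - g (M *v x))"
      by (simp add: matrix_vector_mult_diff_distrib)
    have "(M *v x - M *v g (M *v x)) \<bullet> (M *v x - M *v g (M *v x)) = 0"
      using gO[of "M *v x" "x - g (M *v x)"] by (simp only: e)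
    then show ?thesis by simp
  qed
  have symm: "transpose P = P" if "\<And>x y. (P *v x) \<bullet> y = x \<bullet> (P *v y)" for P :: "real^'a^'a"
  proof -
    have "transpose P *v y = P *v y" for y
      using that by (metis dot_lmul_matrix inner_commute vector_eq_ldot vector_transpose_matrix)
    then show ?thesis by (simp add: matrix_eq)
  qed
  have "is_pinv M ?X"
    unfolding is_pinv_def
  proof (intro conjI)
    show "M ** ?X ** M = M"
      by (simp add: matrix_eq X MXM flip: matrix_vector_mul_assoc)
    show "?X ** M ** ?X = ?X"
      by (simp add: matrix_eq X flip: matrix_vector_mul_assoc)
        (metis MXM gO gS uniq)
    show "transpose (M ** ?X) = M ** ?X"
    proof (rule symm)
      fix x y
      have 1: "(x - M *v g x) \<bullet> (M *v g y) = 0" and 2: "(y - M *v g y) \<bullet> (M *v g x) = 0"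
        using gO by blast+
      have "(M *v g x) \<bullet> y = x \<bullet> (M *v g y)"
        using 1 2 unfolding inner_diff_left
        by (simp add: inner_commute[of "M *v g y" "M *v g x"] inner_commute[of y "M *v g x"])
      then show "((M ** ?X) *v x) \<bullet> y = x \<bullet> ((M ** ?X) *v y)"
        by (simp add: X flip: matrix_vector_mul_assoc)
    qed
    show "transpose (?X ** M) = ?X ** M"
    proof (rule symm)
      fix x y
      have o: "(x - g (M *v x)) \<bullet> s = 0" if "s \<in> ?S" for x s
        using orthogonal_nullspace_rowspace[of M "x - g (M *v x)" s] that
        by (simp add: MXM matrix_vector_mult_diff_distrib orthogonal_def)
      have "g (M *v x) \<bullet> y = x \<bullet> g (M *v y)"
        using o[OF gS, of x "M *v y"] o[OF gS, of y "M *v x"]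
        unfolding inner_diff_left
        by (simp add: inner_commute[of "g (M *v y)" "g (M *v x)"] inner_commute[of y "g (M *v x)"])
      then show "((?X ** M) *v x) \<bullet> y = x \<bullet> ((?X ** M) *v y)"
        by (simp add: X flip: matrix_vector_mul_assoc)
    qed
  qed
  then show ?thesis ..
qed

lemma is_pinv_pinv: "is_pinv M (pinv M)"
  unfolding pinv_def using is_pinv_exists is_pinv_unique by (metis theI')

section \<open>Backward errors for the indefinite least squares problem\<close>

text \<open>The order on the index type \<open>'m\<close> is only used to say which indices are the first \<open>p\<close> ones;
  \<open>p = 0\<close> and \<open>q = 0\<close> are possible.\<close>

definition Sigma_pq :: "nat \<Rightarrow> nat \<Rightarrow> real^('m::{finite,linorder})^('m::{finite,linorder})" where
  "Sigma_pq p q = (\<chi> i j.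
     if i \<noteq> j then 0
     else if card {k. k < i} < p then 1
     else if card {k. k < i} < p + q then -1
     else 0)"

definition residual :: "real^'n^('m::{finite,linorder}) \<Rightarrow> real^('m::{finite,linorder}) \<Rightarrow> real^'n \<Rightarrow> real^('m::{finite,linorder})" where
  "residual A b y = b - A *v y"

definition S_ILSE ::
  "nat \<Rightarrow> nat \<Rightarrow> real^'n^('m::{finite,linorder}) \<Rightarrow> real^('m::{finite,linorder}) \<Rightarrow> real^'n^'s \<Rightarrow> real^'s \<Rightarrow> real^'n
   \<Rightarrow> ((real^'n^('m::{finite,linorder})) \<times> (real^('m::{finite,linorder})) \<times> (real^'n^'s) \<times> (real^'s)) set" where
  "S_ILSE p q A b B d y = {(E, f, F, g).
     \<exists>\<xi>. transpose (A + E) *v (Sigma_pq p q *v (b + f - (A + E) *v y)) = transpose (B + F) *v \<xi>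
        \<and> (B + F) *v y = d + g}"

text \<open>The set below is nonempty (take \<open>E = -A\<close>, \<open>f = -b\<close>, \<open>F = 0\<close>, \<open>g = B y - d\<close>) and bounded below
  by 0, so that the real infimum is the usual one; likewise for \<open>rho\<close>.\<close>

definition mu_ILSE ::
  "nat \<Rightarrow> nat \<Rightarrow> real^'n^('m::{finite,linorder}) \<Rightarrow> real^('m::{finite,linorder}) \<Rightarrow> real^'n^'s \<Rightarrow> real^'s \<Rightarrow> real^'n
   \<Rightarrow> real \<Rightarrow> real \<Rightarrow> real \<Rightarrow> real" where
  "mu_ILSE p q A b B d y \<theta>1 \<theta>2 \<theta>3 =
     (INF (E, f, F, g) \<in> S_ILSE p q A b B d y.
        frobenius_norm
          ((E ||| (columnvector (\<theta>1 *\<^sub>R f) :: real^1^('m::{finite,linorder}))) ///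
           (\<theta>2 *\<^sub>R F ||| (columnvector (\<theta>3 *\<^sub>R g) :: real^1^'s))))"

text \<open>The block multiplying vec(E) in both Jacobian-type matrices.\<close>

definition J_E ::
  "nat \<Rightarrow> nat \<Rightarrow> real^'n^('m::{finite,linorder}) \<Rightarrow> real^('m::{finite,linorder}) \<Rightarrow> real^'n \<Rightarrow> real^('n \<times> 'm)^'n" where
  "J_E p q A b y =
     drop_unit_snd (kronecker (mat 1 :: real^'n^'n)
        ((rowvector (residual A b y) :: real^('m::{finite,linorder})^1) ** Sigma_pq p q))
     - transpose A ** Sigma_pq p q **
         drop_unit_fst (kronecker (rowvector y :: real^'n^1) (mat 1 :: real^('m::{finite,linorder})^('m::{finite,linorder})))"

definition J ::
  "nat \<Rightarrow> nat \<Rightarrow> real^'n^('m::{finite,linorder}) \<Rightarrow> real^('m::{finite,linorder}) \<Rightarrow> real^'n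
   \<Rightarrow> real \<Rightarrow> real \<Rightarrow> real \<Rightarrow> real^'s
   \<Rightarrow> real^(('n \<times> 'm) + 'm + ('n \<times> 's) + 's)^('n + 's)" where
  "J p q A b y \<theta>1 \<theta>2 \<theta>3 \<xi> =
     (J_E p q A b y
        ||| inverse \<theta>1 *\<^sub>R (transpose A ** Sigma_pq p q)
        ||| - (inverse \<theta>2 *\<^sub>R
               drop_unit_snd (kronecker (mat 1 :: real^'n^'n) (rowvector \<xi> :: real^'s^1)))
        ||| 0) ///
     (0 ||| 0
        ||| inverse \<theta>2 *\<^sub>R
               drop_unit_fst (kronecker (rowvector y :: real^'n^1) (mat 1 :: real^'s^'s))
        ||| - (inverse \<theta>3 *\<^sub>R (mat 1 :: real^'s^'s)))"

definition rho_at ::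
  "nat \<Rightarrow> nat \<Rightarrow> real^'n^('m::{finite,linorder}) \<Rightarrow> real^('m::{finite,linorder}) \<Rightarrow> real^'n^'s \<Rightarrow> real^'s \<Rightarrow> real^'n
   \<Rightarrow> real \<Rightarrow> real \<Rightarrow> real \<Rightarrow> real^'s \<Rightarrow> real" where
  "rho_at p q A b B d y \<theta>1 \<theta>2 \<theta>3 \<xi> =
     norm (pinv (J p q A b y \<theta>1 \<theta>2 \<theta>3 \<xi>) *v
       (transpose B *v \<xi> - transpose A *v (Sigma_pq p q *v residual A b y) /// d - B *v y))"

definition rho ::
  "nat \<Rightarrow> nat \<Rightarrow> real^'n^('m::{finite,linorder}) \<Rightarrow> real^('m::{finite,linorder}) \<Rightarrow> real^'n^'s \<Rightarrow> real^'s \<Rightarrow> real^'n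
   \<Rightarrow> real \<Rightarrow> real \<Rightarrow> real \<Rightarrow> real" where
  "rho p q A b B d y \<theta>1 \<theta>2 \<theta>3 = (INF \<xi>. rho_at p q A b B d y \<theta>1 \<theta>2 \<theta>3 \<xi>)"

text \<open>\<open>tau0\<close> depends on \<open>B\<close> only through the number \<open>'s\<close> of its rows.\<close>

definition tau0 ::
  "nat \<Rightarrow> nat \<Rightarrow> real^'n^('m::{finite,linorder}) \<Rightarrow> real^('m::{finite,linorder}) \<Rightarrow> real^'n^'s \<Rightarrow> real^'n
   \<Rightarrow> real \<Rightarrow> real \<Rightarrow> real" where
  "tau0 p q A b B y \<theta>1 \<theta>3 =
     spectral_norm (pinv
       ((J_E p q A b y ||| inverse \<theta>1 *\<^sub>R (transpose A ** Sigma_pq p q) ||| 0) ///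
        (0 ||| 0 ||| - (inverse \<theta>3 *\<^sub>R (mat 1 :: real^'s^'s)))))"

end

theory Submission
  imports Defs
begin

(* In the scaled unknown w = (vec E, \<theta>1 f, \<theta>2 vec F, \<theta>3 g), membership in the perturbation set reads
   J(\<xi>) w + Q(w) = h(\<xi>) with Q quadratic, |Q(w)| \<le> c |w|^2 and c = sqrt (\<theta>1^(-2) + |y|^2).  Since
   r_y \<noteq> 0, the matrix J(\<xi>) has full row rank even without its third block column, so that
   |J(\<xi>)^+ u| \<le> \<tau>0 |u| uniformly in \<xi>.  A solution w satisfies \<rho>(\<xi>) \<le> |w| + \<tau>0 c |w|^2, which gives
   the lower bound; conversely w \<mapsto> J(\<xi>)^+ (h(\<xi>) - Q(w)) maps the ball of radius 2\<rho>(\<xi>) into itself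
   when 4 \<tau>0 c \<rho>(\<xi>) \<le> 1, and a Brouwer fixed point gives the upper bound. *)

section \<open>Block matrices and vectorization\<close>

lemma sum_UNIV_Plus:
  fixes f :: "'a::finite + 'b::finite \<Rightarrow> 'c::comm_monoid_add"
  shows "sum f UNIV = (\<Sum>a\<in>UNIV. f (Inl a)) + (\<Sum>b\<in>UNIV. f (Inr b))"
  unfolding UNIV_Plus_UNIV[symmetric] by (subst sum.Plus) auto

lemma hcat_mult_vcat: "(M ||| N) *v (u /// v) = M *v u + N *v v"
  by (simp add: vec_eq_iff matrix_vector_mult_def hcat_def vcat_def sum_UNIV_Plus)

lemma vcat_mult: "(M /// N) *v u = (M *v u /// N *v u)"
  by (simp add: vec_eq_iff matrix_vector_mult_def vcat_def split: sum.split)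

lemma vcat_add: "(u /// v) + (u' /// v') = ((u + u') /// (v + v'))"
  by (simp add: vec_eq_iff vcat_def split: sum.split)

lemma vcat_eq_iff: "(u /// v) = (u' /// v') \<longleftrightarrow> u = u' \<and> v = v'"
  by (auto simp: vec_eq_iff vcat_def split: sum.splits)

lemma vcat_surj: "\<exists>u v. w = (u /// v)"
  by (intro exI[of _ "\<chi> i. w $ Inl i"] exI[of _ "\<chi> i. w $ Inr i"])
    (simp add: vec_eq_iff vcat_def split: sum.split)

lemma norm_vec_power2: "(norm x)\<^sup>2 = (\<Sum>i\<in>UNIV. (norm (x $ i))\<^sup>2)"
  by (simp add: norm_vec_def L2_set_def sum_nonneg)

lemma norm_vcat_power2:
  fixes u :: "'c::real_normed_vector^'r" and v :: "'c^'s"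
  shows "(norm (u /// v))\<^sup>2 = (norm u)\<^sup>2 + (norm v)\<^sup>2"
  by (simp add: norm_vec_power2 vcat_def sum_UNIV_Plus)

lemma norm_hcat_power2: "(norm (M ||| N))\<^sup>2 = (norm M)\<^sup>2 + (norm N)\<^sup>2"
  by (simp add: norm_vec_power2 hcat_def sum_UNIV_Plus sum.distrib)

lemma uminus_matrix_vector_mult: "(- M) *v x = - (M *v x)" for M :: "real^'n^'m"
  by (simp add: matrix_vector_mult_def vec_eq_iff sum_negf)

lemma rowvector_row: "(rowvector v :: real^'n^1) $ i = v"
  by (simp add: rowvector_def vec_eq_iff)

lemma norm_columnvector: "norm (columnvector v :: real^1^'m) = norm v"
  by (simp add: norm_vec_def columnvector_def L2_set_def)

lemma norm_transpose: "norm (transpose M :: real^'m^'n) = norm M"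
proof -
  have "(norm (transpose M))\<^sup>2 = (norm M)\<^sup>2"
    unfolding norm_vec_power2 by (simp add: transpose_def) (rule sum.swap)
  then show ?thesis by simp
qed

text \<open>The norm of the type \<open>real^'n^'m\<close> is the Frobenius norm, so Cauchy-Schwarz
  on each row and summation of the squares suffice.\<close>

lemma norm_matrix_vector_mult_le:
  fixes M :: "real^'n^'m"
  shows "norm (M *v x) \<le> norm M * norm x"
proof -
  have "(norm (M *v x))\<^sup>2 \<le> (\<Sum>i\<in>UNIV. (norm (M $ i) * norm x)\<^sup>2)"
    unfolding norm_vec_power2[of "M *v x"]
    by (intro sum_mono power_mono)
      (auto simp: matrix_vector_mul_component Cauchy_Schwarz_ineq2)
  also have "\<dots> = (norm M * norm x)\<^sup>2"
    by (simp add: norm_vec_power2[of M] power_mult_distrib sum_distrib_right)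
  finally show ?thesis by (rule power2_le_imp_le) simp
qed

text \<open>The column index comes first, matching the column indices of \<open>kronecker\<close>,
  so that the blocks of \<open>J\<close> act on vec(M) directly.\<close>

definition vec_of :: "real^'n^'m \<Rightarrow> real^('n \<times> 'm)" where
  "vec_of M = (\<chi> k. M $ snd k $ fst k)"

lemma vec_of_surj: "\<exists>M. w = vec_of M"
  by (rule exI[of _ "\<chi> i j. w $ (j, i)"]) (simp add: vec_of_def vec_eq_iff)

lemma norm_vec_of: "norm (vec_of M) = norm M"
proof -
  have "(norm (vec_of M))\<^sup>2 = (norm M)\<^sup>2"
    unfolding norm_vec_power2 vec_of_def
    by (simp add: sum.swap[of _ "UNIV :: 'a set"] UNIV_Times_UNIV[symmetric] sum.cartesian_product'
        del: UNIV_Times_UNIV)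
  then show ?thesis by simp
qed

text \<open>Case C = I of (C^T (x) R) vec(M) = vec(R M C). The row R M is read as a vector, hence
  the transpose.\<close>

lemma kronecker_mat_1_row_mult_vec_of:
  "drop_unit_snd (kronecker (mat 1 :: real^'n^'n) R) *v vec_of M = transpose M *v (R $ 1)"
proof -
  have "(drop_unit_snd (kronecker (mat 1 :: real^'n^'n) R) *v vec_of M) $ j
      = (transpose M *v (R $ 1)) $ j" for j
  proof -
    have "(drop_unit_snd (kronecker (mat 1 :: real^'n^'n) R) *v vec_of M) $ j
        = (\<Sum>k\<in>UNIV. \<Sum>i\<in>UNIV. (if j = k then R $ 1 $ i * M $ i $ k else 0))"
      unfolding matrix_vector_mult_def drop_unit_snd_def kronecker_def vec_of_def mat_def
      by (simp add: UNIV_Times_UNIV[symmetric] sum.cartesian_product' if_distrib if_distribR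
          del: UNIV_Times_UNIV cong: if_cong)
    also have "\<dots> = (\<Sum>k\<in>UNIV. if j = k then (\<Sum>i\<in>UNIV. R $ 1 $ i * M $ i $ k) else 0)"
      by (rule sum.cong) auto
    also have "\<dots> = (transpose M *v (R $ 1)) $ j"
      by (simp add: matrix_vector_mult_def transpose_def mult.commute)
    finally show ?thesis .
  qed
  then show ?thesis by (simp add: vec_eq_iff)
qed

text \<open>The same identity with C = y and R = I.\<close>

lemma kronecker_rowvector_mat_1_mult_vec_of:
  "drop_unit_fst (kronecker (rowvector y) (mat 1 :: real^'m^'m)) *v vec_of M = M *v y"
proof -
  have "(drop_unit_fst (kronecker (rowvector y) (mat 1 :: real^'m^'m)) *v vec_of M) $ i
      = (M *v y) $ i" for i
  proof -
    have "(drop_unit_fst (kronecker (rowvector y) (mat 1 :: real^'m^'m)) *v vec_of M) $ i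
        = (\<Sum>j\<in>UNIV. \<Sum>k\<in>UNIV. (if i = k then y $ j * M $ k $ j else 0))"
      unfolding matrix_vector_mult_def drop_unit_fst_def kronecker_def vec_of_def mat_def
        rowvector_def
      by (simp add: UNIV_Times_UNIV[symmetric] sum.cartesian_product' if_distrib if_distribR
          del: UNIV_Times_UNIV cong: if_cong)
    also have "\<dots> = (M *v y) $ i"
      by (simp add: matrix_vector_mult_def mult.commute)
    finally show ?thesis .
  qed
  then show ?thesis by (simp add: vec_eq_iff)
qed

section \<open>Minimum norm solutions\<close>

lemma pinv_surj_right_inverse:
  assumes "surj ((*v) M)"
  shows "M *v (pinv M *v u) = u"
proof -
  obtain x where "u = M *v x" using assms by (metis surjD)
  moreover have "M ** pinv M ** M = M" using is_pinv_pinv by (auto simp: is_pinv_def)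
  ultimately show ?thesis by (simp add: matrix_vector_mul_assoc matrix_mul_assoc)
qed

text \<open>M^+ M is symmetric and idempotent, hence an orthogonal projection. Consequently M^+ u is
  no longer than any w with M w = u.\<close>

lemma norm_pinv_mult_le: "norm (pinv M *v (M *v w)) \<le> norm w"
proof -
  let ?P = "pinv M ** M"
  have "transpose ?P = ?P" and "pinv M ** M ** pinv M = pinv M"
    using is_pinv_pinv[of M] by (auto simp: is_pinv_def)
  then have idem: "?P *v (?P *v w) = ?P *v w" and
    symm: "(?P *v w) \<bullet> (?P *v w) = w \<bullet> (?P *v (?P *v w))"
    by (simp add: matrix_vector_mul_assoc matrix_mul_assoc)
      (metis \<open>transpose ?P = ?P\<close> dot_lmul_matrix vector_transpose_matrix)
  have "(norm (?P *v w))\<^sup>2 \<le> norm w * norm (?P *v w)"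
    using symm idem norm_cauchy_schwarz[of w "?P *v w"]
    by (simp add: dot_square_norm)
  then have "norm (?P *v w) \<le> norm w"
    by (cases "norm (?P *v w) = 0") (auto simp: power2_eq_square)
  then show ?thesis by (simp add: matrix_vector_mul_assoc)
qed

lemma norm_pinv_le_spectral_norm: "norm (pinv M *v u) \<le> spectral_norm (pinv M) * norm u"
  unfolding spectral_norm_def by (rule onorm) simp

text \<open>As M M^+ = I, fixed points of w |-> M^+ (h - Q w) are solutions. With r = |M^+ h|, the
  correction on the ball of radius 2r is at most \<tau> c (2r)^2 = (4 \<tau> c r) r \<le> r, so the
  ball is mapped into itself and Brouwer's theorem applies.\<close>

lemma quadratic_perturbation_solvable:
  fixes M :: "real^'k^'l" and Q :: "real^'k \<Rightarrow> real^'l"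
  assumes "surj ((*v) M)"
    and \<tau>: "\<And>u. norm (pinv M *v u) \<le> \<tau> * norm u" "0 \<le> \<tau>"
    and Q: "\<And>w. norm (Q w) \<le> c * (norm w)\<^sup>2" "0 \<le> c"
    and cont: "continuous_on UNIV Q"
    and small: "4 * \<tau> * c * norm (pinv M *v h) \<le> 1"
  obtains w where "M *v w + Q w = h" and "norm w \<le> 2 * norm (pinv M *v h)"
proof -
  let ?r = "norm (pinv M *v h)"
  let ?G = "\<lambda>w. pinv M *v (h - Q w)"
  have "?G \<in> cball 0 (2 * ?r) \<rightarrow> cball 0 (2 * ?r)"
  proof
    fix w :: "real^'k" assume "w \<in> cball 0 (2 * ?r)"
    then have "(norm w)\<^sup>2 \<le> (2 * ?r)\<^sup>2" by (intro power_mono) auto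
    then have "\<tau> * norm (Q w) \<le> \<tau> * (c * (2 * ?r)\<^sup>2)"
      using Q(1)[of w] by (intro mult_left_mono[OF _ \<tau>(2)]) (meson Q(2) mult_left_mono order_trans)
    also have "\<dots> = (4 * \<tau> * c * ?r) * ?r" by (simp add: power2_eq_square)
    also have "\<dots> \<le> 1 * ?r" by (rule mult_right_mono[OF small]) simp
    finally have "norm (pinv M *v Q w) \<le> ?r" using \<tau>(1)[of "Q w"] by simp
    then have "norm (?G w) \<le> ?r + ?r"
      unfolding matrix_vector_mult_diff_distrib by (intro norm_triangle_le_diff) simp
    then show "?G w \<in> cball 0 (2 * ?r)" by simp
  qed
  moreover have "continuous_on (cball 0 (2 * ?r)) ?G"
    by (intro linear_continuous_on_compose[OF _ matrix_vector_mul_linear] continuous_intros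
        continuous_on_subset[OF cont]) auto
  ultimately obtain w where w: "w \<in> cball 0 (2 * ?r)" "?G w = w"
    using brouwer[of "cball 0 (2 * ?r)" ?G] by (metis cball_eq_empty compact_cball convex_cball
      mult_nonneg_nonneg norm_ge_zero not_less zero_le_numeral)
  have "M *v w = h - Q w"
    using pinv_surj_right_inverse[OF assms(1), of "h - Q w"] w(2) by simp
  then show thesis using w(1) by (intro that[of w]) auto
qed

section \<open>The linearized problem\<close>

lemma transpose_Sigma_pq: "transpose (Sigma_pq p q) = Sigma_pq p q"
  by (auto simp: Sigma_pq_def transpose_def vec_eq_iff)

lemma norm_Sigma_pq_mult:
  fixes x :: "real^('m::{finite,linorder})"
  assumes "p + q = CARD('m)"
  shows "norm (Sigma_pq p q *v x) = norm x"
proof -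
  \<comment> \<open>Since p + q = m, the default entry 0 in \<open>Sigma_pq\<close> never occurs on
    the diagonal.\<close>
  have less: "card {k. k < i} < p + q" for i :: 'm
    unfolding assms by (rule psubset_card_mono) auto
  have "\<bar>(Sigma_pq p q *v x) $ i\<bar> = \<bar>x $ i\<bar>" for i
  proof -
    define \<sigma> :: real where "\<sigma> = (if card {k. k < i} < p then 1 else -1)"
    have "Sigma_pq p q $ i $ j = (if i = j then \<sigma> else 0)" for j
      using less[of i] by (auto simp: Sigma_pq_def \<sigma>_def)
    then have "(Sigma_pq p q *v x) $ i = \<sigma> * x $ i"
      by (simp add: matrix_vector_mult_def if_distrib[of "\<lambda>t. t * _"] cong: if_cong)
    then show ?thesis by (simp add: \<sigma>_def abs_mult)
  qed
  then show ?thesis by (simp add: norm_vec_def)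
qed

text \<open>The value is the derivative of A |-> A^T Sigma (b - A y) in direction E.\<close>

lemma J_E_mult_vec_of:
  fixes A :: "real^'n^('m::{finite,linorder})"
  shows "J_E p q A b y *v vec_of E = transpose E *v (Sigma_pq p q *v residual A b y)
     - transpose A *v (Sigma_pq p q *v (E *v y))"
proof -
  have "((rowvector (residual A b y) :: real^_^1) ** Sigma_pq p q) $ 1
      = transpose (Sigma_pq p q) *v residual A b y"
    by (simp add: vec_eq_iff matrix_matrix_mult_def matrix_vector_mult_def rowvector_def
        transpose_def mult.commute)
  then show ?thesis
    unfolding J_E_def matrix_vector_mult_diff_rdistrib kronecker_mat_1_row_mult_vec_of
    by (simp add: transpose_Sigma_pq kronecker_rowvector_mat_1_mult_vec_of
        flip: matrix_vector_mul_assoc)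
qed

text \<open>The matrix inside \<open>tau0\<close>: J(\<xi>) with its third block column deleted,
  which is the only one that contains \<xi>.\<close>

definition J0 ::
  "nat \<Rightarrow> nat \<Rightarrow> real^'n^('m::{finite,linorder}) \<Rightarrow> real^('m::{finite,linorder}) \<Rightarrow> real^'n \<Rightarrow> real \<Rightarrow> real
   \<Rightarrow> real^(('n \<times> ('m::{finite,linorder})) + ('m::{finite,linorder}) + ('s::finite))^('n + ('s::finite))" where
  "J0 p q A b y \<theta>1 \<theta>3 =
     (J_E p q A b y ||| inverse \<theta>1 *\<^sub>R (transpose A ** Sigma_pq p q) ||| 0) ///
     (0 ||| 0 ||| - (inverse \<theta>3 *\<^sub>R (mat 1 :: real^'s^'s)))"

lemma tau0_eq:
  fixes A :: "real^'n^('m::{finite,linorder})" and B :: "real^'n^'s"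
  shows "tau0 p q A b B y \<theta>1 \<theta>3
    = spectral_norm (pinv (J0 p q A b y \<theta>1 \<theta>3 :: real^(('n \<times> 'm) + 'm + 's)^('n + 's::finite)))"
  by (simp add: tau0_def J0_def)

lemma J0_mult:
  "J0 p q A b y \<theta>1 \<theta>3 *v (e /// f /// g) =
     (J_E p q A b y *v e + inverse \<theta>1 *\<^sub>R (transpose A *v (Sigma_pq p q *v f))
      /// - (inverse \<theta>3 *\<^sub>R g))"
  by (simp add: J0_def vcat_mult hcat_mult_vcat scaleR_matrix_vector_assoc[symmetric]
      matrix_vector_mul_assoc[symmetric] uminus_matrix_vector_mult)

lemma J_mult:
  "J p q A b y \<theta>1 \<theta>2 \<theta>3 \<xi> *v (e /// f /// vec_of F /// g) =
     (J_E p q A b y *v e + inverse \<theta>1 *\<^sub>R (transpose A *v (Sigma_pq p q *v f))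
        - inverse \<theta>2 *\<^sub>R (transpose F *v \<xi>)
      /// inverse \<theta>2 *\<^sub>R (F *v y) - inverse \<theta>3 *\<^sub>R g)"
  by (simp add: J_def vcat_mult hcat_mult_vcat scaleR_matrix_vector_assoc[symmetric]
      matrix_vector_mul_assoc[symmetric] kronecker_mat_1_row_mult_vec_of
      kronecker_rowvector_mat_1_mult_vec_of uminus_matrix_vector_mult rowvector_row
      add_diff_eq)

text \<open>This is where r_y \<noteq> 0 enters: Sigma preserves the norm, so z = Sigma r_y is
  nonzero and E |-> E^T z alone reaches every vector.\<close>

lemma J0_surj:
  fixes A :: "real^'n^('m::{finite,linorder})"
  assumes "p + q = CARD('m)" and "\<theta>1 \<noteq> 0" and "\<theta>3 \<noteq> 0" and "residual A b y \<noteq> 0"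
  shows "surj ((*v) (J0 p q A b y \<theta>1 \<theta>3 :: real^(('n \<times> 'm) + 'm + 's)^('n + 's::finite)))"
proof -
  define z where "z = Sigma_pq p q *v residual A b y"
  have z_nz: "z \<bullet> z \<noteq> 0"
    using norm_Sigma_pq_mult[OF assms(1), of "residual A b y"] assms(4)
    by (metis z_def inner_eq_zero_iff norm_eq_zero)
  have "\<exists>w. h = J0 p q A b y \<theta>1 \<theta>3 *v w" for h :: "real^('n + 's)"
  proof -
    obtain u v where h: "h = (u /// v)" using vcat_surj by blast
    \<comment> \<open>The rank one matrix z u^T / |z|^2 solves E^T z = u.\<close>
    define E where "E = (\<chi> i j. z $ i * u $ j / (z \<bullet> z))"
    have "(transpose E *v z) $ j = u $ j" for j
    proof -
      have "(transpose E *v z) $ j = (\<Sum>i\<in>UNIV. z $ i * z $ i) * u $ j / (z \<bullet> z)"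
        by (simp add: matrix_vector_mult_def transpose_def E_def
            sum_distrib_left sum_divide_distrib mult_ac)
      also have "(\<Sum>i\<in>UNIV. z $ i * z $ i) = z \<bullet> z" by (simp add: inner_vec_def)
      finally show ?thesis using z_nz by simp
    qed
    then have "transpose E *v z = u" by (simp add: vec_eq_iff)
    \<comment> \<open>The second block cancels the term - A^T Sigma E y coming from
      \<open>J_E\<close>; the last block produces v.\<close>
    then have "h = J0 p q A b y \<theta>1 \<theta>3 *v (vec_of E /// \<theta>1 *\<^sub>R (E *v y) /// - (\<theta>3 *\<^sub>R v))"
      using assms(2,3) by (simp add: h J0_mult J_E_mult_vec_of z_def[symmetric] matrix_vector_mult_scaleR)
    then show ?thesis by blast
  qed
  then show ?thesis by (metis surjI surj_def)
qed

text \<open>A zero block is inserted in the position of vec(F), which costs no norm and removes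
  \<xi> from the product.\<close>

lemma J_solution_from_J0:
  fixes A :: "real^'n^('m::{finite,linorder})" and \<xi> :: "real^'s"
    and w :: "real^(('n \<times> 'm) + 'm + 's)"
  obtains w' where "J p q A b y \<theta>1 \<theta>2 \<theta>3 \<xi> *v w' = J0 p q A b y \<theta>1 \<theta>3 *v w"
    and "norm w' = norm w"
proof -
  obtain e f g where w: "w = (e /// f /// g)" by (metis vcat_surj)
  let ?w' = "e /// f /// vec_of (0 :: real^'n^'s) /// g"
  have "(norm ?w')\<^sup>2 = (norm w)\<^sup>2"
    unfolding w norm_vcat_power2 norm_vec_of by simp
  then have "norm ?w' = norm w" by simp
  then show thesis
    by (intro that[of ?w']) (auto simp: J_mult J0_mult w transpose_def[of 0] vec_eq_iff
        matrix_vector_mult_def[of "\<chi> i j. (0::real)"] zero_vec_def[symmetric])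
qed

text \<open>The zero-padded minimum norm solution for \<open>J0\<close> also solves the system with
  J(\<xi>), so the minimum norm solution of the latter is at most as long. This makes the bound
  uniform in \<xi>.\<close>

lemma
  fixes A :: "real^'n^('m::{finite,linorder})" and B :: "real^'n^'s" and \<xi> :: "real^'s"
  assumes "p + q = CARD('m)" and "\<theta>1 \<noteq> 0" and "\<theta>3 \<noteq> 0" and "residual A b y \<noteq> 0"
  shows J_surj: "surj ((*v) (J p q A b y \<theta>1 \<theta>2 \<theta>3 \<xi>))"
    and norm_pinv_J_le:
      "norm (pinv (J p q A b y \<theta>1 \<theta>2 \<theta>3 \<xi>) *v u) \<le> tau0 p q A b B y \<theta>1 \<theta>3 * norm u"
proof -
  let ?K = "J0 p q A b y \<theta>1 \<theta>3 :: real^(('n \<times> 'm) + 'm + 's)^('n + 's)"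
  let ?J = "J p q A b y \<theta>1 \<theta>2 \<theta>3 \<xi>"
  have sol: "\<exists>w. ?J *v w = u \<and> norm w = norm (pinv ?K *v u)" for u
  proof -
    obtain w where "?J *v w = ?K *v (pinv ?K *v u)" and "norm w = norm (pinv ?K *v u)"
      by (rule J_solution_from_J0)
    then show ?thesis using pinv_surj_right_inverse[OF J0_surj[OF assms]] by metis
  qed
  then show "surj ((*v) ?J)" by (metis surj_def)
  obtain w where w: "?J *v w = u" and norm_w: "norm w = norm (pinv ?K *v u)" using sol by blast
  have "norm (pinv ?J *v u) \<le> norm w"
    using norm_pinv_mult_le[of ?J w] w by simp
  also have "norm w \<le> tau0 p q A b B y \<theta>1 \<theta>3 * norm u"
    unfolding norm_w tau0_eq by (rule norm_pinv_le_spectral_norm)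
  finally show "norm (pinv ?J *v u) \<le> tau0 p q A b B y \<theta>1 \<theta>3 * norm u" .
qed

section \<open>The perturbation set as a quadratic perturbation of the linearized problem\<close>

text \<open>The weights turn the weighted Frobenius norm minimized in \<open>mu_ILSE\<close> into a
  Euclidean norm; the inverse weights in \<open>J\<close> undo them.\<close>

definition perturbation_vec ::
  "real \<Rightarrow> real \<Rightarrow> real \<Rightarrow> real^'n^'m \<Rightarrow> real^'m \<Rightarrow> real^'n^'s \<Rightarrow> real^'s
   \<Rightarrow> real^(('n \<times> 'm) + 'm + ('n \<times> 's) + 's)" where
  "perturbation_vec \<theta>1 \<theta>2 \<theta>3 E f F g =
     (vec_of E /// \<theta>1 *\<^sub>R f /// vec_of (\<theta>2 *\<^sub>R F) /// \<theta>3 *\<^sub>R g)"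

lemma norm_perturbation_vec:
  fixes E :: "real^'n^'m" and F :: "real^'n^'s"
  shows "frobenius_norm
      ((E ||| (columnvector (\<theta>1 *\<^sub>R f) :: real^1^'m)) ///
       (\<theta>2 *\<^sub>R F ||| (columnvector (\<theta>3 *\<^sub>R g) :: real^1^'s)))
    = norm (perturbation_vec \<theta>1 \<theta>2 \<theta>3 E f F g)"
proof -
  have "(norm ((E ||| (columnvector (\<theta>1 *\<^sub>R f) :: real^1^'m)) ///
       (\<theta>2 *\<^sub>R F ||| (columnvector (\<theta>3 *\<^sub>R g) :: real^1^'s))))\<^sup>2
    = (norm (perturbation_vec \<theta>1 \<theta>2 \<theta>3 E f F g))\<^sup>2"
    unfolding perturbation_vec_def norm_vcat_power2 norm_hcat_power2 norm_columnvector norm_vec_of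
    by simp
  then show ?thesis by (simp add: frobenius_norm_eq_norm)
qed

lemma perturbation_vec_surj:
  assumes "\<theta>1 \<noteq> 0" and "\<theta>2 \<noteq> 0" and "\<theta>3 \<noteq> 0"
  shows "\<exists>E f F g. w = perturbation_vec \<theta>1 \<theta>2 \<theta>3 E f F g"
proof -
  obtain e f' F' g' where w: "w = (e /// f' /// F' /// g')" by (metis vcat_surj)
  obtain E F where "e = vec_of E" "F' = vec_of F" by (metis vec_of_surj)
  then have "w = perturbation_vec \<theta>1 \<theta>2 \<theta>3 E (inverse \<theta>1 *\<^sub>R f') (inverse \<theta>2 *\<^sub>R F)
      (inverse \<theta>3 *\<^sub>R g')"
    using assms by (simp add: w perturbation_vec_def)
  then show ?thesis by blast
qed

text \<open>The second-order remainder of the stationarity equation, as a function of the scaled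
  unknown. The product F^T \<xi> contributes nothing because \<xi> is a parameter of J(\<xi>), and
  the constraint is already affine, hence the zero block.\<close>

definition quadratic_term ::
  "nat \<Rightarrow> nat \<Rightarrow> real^'n \<Rightarrow> real \<Rightarrow> real^(('n \<times> ('m::{finite,linorder})) + ('m::{finite,linorder}) + 'r::finite)
   \<Rightarrow> real^('n + 's::finite)" where
  "quadratic_term p q y \<theta>1 w =
     (let E = (\<chi> i j. w $ Inl (j, i)); f = (\<chi> i. inverse \<theta>1 * w $ Inr (Inl i))
      in (transpose E *v (Sigma_pq p q *v (f - E *v y)) /// 0))"

lemma quadratic_term_vcat:
  "quadratic_term p q y \<theta>1 (vec_of E /// \<theta>1 *\<^sub>R f /// z)
    = (transpose E *v (Sigma_pq p q *v (f - E *v y)) /// 0)" if "\<theta>1 \<noteq> 0"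
proof -
  have "(\<chi> i j. (vec_of E /// \<theta>1 *\<^sub>R f /// z) $ Inl (j, i)) = E"
    and "(\<chi> i. inverse \<theta>1 * (vec_of E /// \<theta>1 *\<^sub>R f /// z) $ Inr (Inl i)) = f"
    using that by (simp_all add: vec_eq_iff vcat_def vec_of_def)
  then show ?thesis by (simp add: quadratic_term_def Let_def)
qed

text \<open>Every coordinate is a polynomial in the entries of w.\<close>

lemma continuous_on_quadratic_term:
  fixes y :: "real^'n"
  shows "continuous_on S (quadratic_term p q y \<theta>1
    :: real^(('n \<times> ('m::{finite,linorder})) + ('m::{finite,linorder}) + 'r::finite) \<Rightarrow> real^('n + 's::finite))"
  unfolding quadratic_term_def Let_def vcat_def
proof (rule continuous_on_vec_lambda)
  fix i :: "'n + 's"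
  show "continuous_on S (\<lambda>w. case i of
      Inl j \<Rightarrow> (transpose (\<chi> i j. w $ Inl (j, i)) *v (Sigma_pq p q *v
        ((\<chi> i. inverse \<theta>1 * w $ Inr (Inl i)) - (\<chi> i j. w $ Inl (j, i)) *v y))) $ j
    | Inr k \<Rightarrow> 0 $ k)"
    by (cases i)
      (simp_all add: matrix_vector_mult_def transpose_def, intro continuous_intros)
qed

lemma norm_quadratic_term_le:
  fixes y :: "real^'n" and w :: "real^(('n \<times> ('m::{finite,linorder})) + ('m::{finite,linorder}) + 'r::finite)"
  assumes "p + q = CARD('m)" and "\<theta>1 > 0"
  shows "norm (quadratic_term p q y \<theta>1 w :: real^('n + 's::finite))
    \<le> sqrt (\<theta>1 powi (-2) + (norm y)\<^sup>2) * (norm w)\<^sup>2"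
proof -
  let ?c = "sqrt (\<theta>1 powi (-2) + (norm y)\<^sup>2)"
  obtain e f' z where "w = (e /// f' /// z)" by (metis vcat_surj)
  moreover obtain E where "e = vec_of E" by (metis vec_of_surj)
  moreover have "f' = \<theta>1 *\<^sub>R (inverse \<theta>1 *\<^sub>R f')" using assms by simp
  ultimately obtain f where w: "w = (vec_of E /// \<theta>1 *\<^sub>R f /// z)" by metis
  let ?x = "sqrt ((norm (\<theta>1 *\<^sub>R f))\<^sup>2 + (norm E)\<^sup>2)"
  have w2: "(norm w)\<^sup>2 = (norm E)\<^sup>2 + (norm (\<theta>1 *\<^sub>R f))\<^sup>2 + (norm z)\<^sup>2"
    unfolding w norm_vcat_power2 norm_vec_of by simp
  then have x: "?x \<le> norm w" and E: "norm E \<le> norm w"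
    by (auto intro!: real_le_lsqrt power2_le_imp_le[of "norm E"])
  have "norm (quadratic_term p q y \<theta>1 w :: real^('n + 's))
      = norm (transpose E *v (Sigma_pq p q *v (f - E *v y)))"
  proof -
    have "(norm (quadratic_term p q y \<theta>1 w :: real^('n + 's)))\<^sup>2
      = (norm (transpose E *v (Sigma_pq p q *v (f - E *v y))))\<^sup>2"
      using assms unfolding w by (simp add: quadratic_term_vcat norm_vcat_power2)
    then show ?thesis by simp
  qed
  also have "\<dots> \<le> norm E * norm (f - E *v y)"
    using norm_matrix_vector_mult_le[of "transpose E"] norm_Sigma_pq_mult[OF assms(1)]
    by (metis norm_transpose)
  also have "\<dots> \<le> norm w * (?c * norm w)"
  proof (rule mult_mono[OF E])
    have e: "inverse \<theta>1 * norm (\<theta>1 *\<^sub>R f) = norm f" using assms(2) by simp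
    have "norm (f - E *v y) \<le> inverse \<theta>1 * norm (\<theta>1 *\<^sub>R f) + norm y * norm E"
      unfolding e
      using norm_triangle_ineq4[of f "E *v y"] norm_matrix_vector_mult_le[of E y]
      by (simp add: mult.commute)
    \<comment> \<open>Cauchy-Schwarz in the plane produces the constant sqrt (\<theta>1^(-2) +
      |y|^2).\<close>
    also have "\<dots> = (inverse \<theta>1, norm y) \<bullet> (norm (\<theta>1 *\<^sub>R f), norm E)" by simp
    also have "\<dots> \<le> norm (inverse \<theta>1, norm y) * norm (norm (\<theta>1 *\<^sub>R f), norm E)"
      by (rule norm_cauchy_schwarz)
    also have "norm (inverse \<theta>1, norm y) = ?c"
      by (simp add: norm_Pair power_int_minus power_inverse)
    also have "norm (norm (\<theta>1 *\<^sub>R f), norm E) = ?x" by (simp add: norm_Pair)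
    also have "?c * ?x \<le> ?c * norm w" using x assms(2) by (intro mult_left_mono) auto
    finally show "norm (f - E *v y) \<le> ?c * norm w" .
  qed simp_all
  finally show ?thesis by (simp add: power2_eq_square mult_ac)
qed

text \<open>The new residual is r_y + (f - E y). After expansion, the terms of order zero give the
  right-hand side up to sign, those of order one give J(\<xi>) w, and the only one of order two is
  E^T Sigma (f - E y). The equivalence holds for each multiplier \<xi> separately.\<close>

lemma S_ILSE_iff:
  fixes A :: "real^'n^('m::{finite,linorder})" and B :: "real^'n^'s"
  assumes "\<theta>1 \<noteq> 0" and "\<theta>2 \<noteq> 0" and "\<theta>3 \<noteq> 0"
  defines "w E f F g \<equiv> perturbation_vec \<theta>1 \<theta>2 \<theta>3 E f F g"
  shows "(E, f, F, g) \<in> S_ILSE p q A b B d y \<longleftrightarrow>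
    (\<exists>\<xi>. J p q A b y \<theta>1 \<theta>2 \<theta>3 \<xi> *v w E f F g + quadratic_term p q y \<theta>1 (w E f F g)
      = (transpose B *v \<xi> - transpose A *v (Sigma_pq p q *v residual A b y) /// d - B *v y))"
proof -
  have "(transpose (A + E) *v (Sigma_pq p q *v (b + f - (A + E) *v y)) = transpose (B + F) *v \<xi>
        \<and> (B + F) *v y = d + g) \<longleftrightarrow>
    J p q A b y \<theta>1 \<theta>2 \<theta>3 \<xi> *v w E f F g + quadratic_term p q y \<theta>1 (w E f F g)
      = (transpose B *v \<xi> - transpose A *v (Sigma_pq p q *v residual A b y) /// d - B *v y)" for \<xi>
  proof -
    let ?r = "residual A b y" and ?S = "Sigma_pq p q"
    let ?P = "transpose E *v (?S *v ?r) - transpose A *v (?S *v (E *v y))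
      + transpose A *v (?S *v f) - transpose F *v \<xi> + transpose E *v (?S *v (f - E *v y))"
    have tr: "transpose (X + Y) = transpose X + transpose Y" for X Y :: "real^'x^'z"
      by (simp add: transpose_def vec_eq_iff)
    have lhs: "J p q A b y \<theta>1 \<theta>2 \<theta>3 \<xi> *v w E f F g + quadratic_term p q y \<theta>1 (w E f F g)
        = (?P /// F *v y - g)"
      using assms(1-3)
      unfolding w_def perturbation_vec_def J_mult quadratic_term_vcat[OF assms(1)] vcat_add
        vcat_eq_iff J_E_mult_vec_of
      by (simp add: transpose_scalar matrix_vector_mult_scaleR
          scaleR_matrix_vector_assoc[symmetric] del: transpose_matrix_vector)
    have eq1: "transpose (A + E) *v (?S *v (b + f - (A + E) *v y)) - transpose (B + F) *v \<xi>
        = ?P - (transpose B *v \<xi> - transpose A *v (?S *v ?r))"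
    proof -
      have "b + f - (A + E) *v y = ?r + (f - E *v y)"
        by (simp add: residual_def matrix_vector_mult_add_rdistrib)
      then show ?thesis
        by (simp add: residual_def tr matrix_vector_mult_add_rdistrib matrix_vector_right_distrib
            matrix_vector_mult_diff_distrib del: transpose_matrix_vector)
    qed
    have eq2: "(B + F) *v y - (d + g) = F *v y - g - (d - B *v y)"
      by (simp add: matrix_vector_mult_add_rdistrib)
    show ?thesis
      using arg_cong[OF eq1, of "\<lambda>v. v = 0"] arg_cong[OF eq2, of "\<lambda>v. v = 0"]
      unfolding lhs vcat_eq_iff right_minus_eq by (simp only:)
  qed
  then show ?thesis by (simp only: S_ILSE_def mem_Collect_eq case_prod_conv)
qed

section \<open>The two-sided bound for the backward error\<close>

theorem corollary2p3:
  fixes A :: "real^'n^('m::{finite,linorder})" and b :: "real^('m::{finite,linorder})"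
    and B :: "real^'n^'s" and d :: "real^'s" and y :: "real^'n"
    and p q :: nat and \<theta>1 \<theta>2 \<theta>3 :: real
  assumes "CARD('n) \<le> CARD('m)"
    and "p + q = CARD('m)"
    and "\<theta>1 > 0" and "\<theta>2 > 0" and "\<theta>3 > 0"
    and "residual A b y \<noteq> 0"
    and "4 * tau0 p q A b B y \<theta>1 \<theta>3 * rho p q A b B d y \<theta>1 \<theta>2 \<theta>3
           * sqrt (\<theta>1 powi (-2) + (norm y)\<^sup>2) < 1"
  shows "2 * rho p q A b B d y \<theta>1 \<theta>2 \<theta>3 / (1 + sqrt 2) \<le> mu_ILSE p q A b B d y \<theta>1 \<theta>2 \<theta>3
    \<and> mu_ILSE p q A b B d y \<theta>1 \<theta>2 \<theta>3 \<le> 2 * rho p q A b B d y \<theta>1 \<theta>2 \<theta>3"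
proof -
  let ?\<tau> = "tau0 p q A b B y \<theta>1 \<theta>3"
  let ?\<rho> = "rho p q A b B d y \<theta>1 \<theta>2 \<theta>3"
  let ?\<rho>\<xi> = "rho_at p q A b B d y \<theta>1 \<theta>2 \<theta>3"
  let ?\<mu> = "mu_ILSE p q A b B d y \<theta>1 \<theta>2 \<theta>3"
  let ?S = "S_ILSE p q A b B d y"
  let ?w = "perturbation_vec \<theta>1 \<theta>2 \<theta>3 :: _ \<Rightarrow> _ \<Rightarrow> real^'n^'s \<Rightarrow> _"
  let ?J = "J p q A b y \<theta>1 \<theta>2 \<theta>3 :: real^'s \<Rightarrow> _"
  let ?Q = "quadratic_term p q y \<theta>1"
  define h where "h \<xi> = (transpose B *v \<xi> - transpose A *v (Sigma_pq p q *v residual A b y)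
    /// d - B *v y)" for \<xi>
  define c where "c = sqrt (\<theta>1 powi (-2) + (norm y)\<^sup>2)"
  have nz: "\<theta>1 \<noteq> 0" "\<theta>2 \<noteq> 0" "\<theta>3 \<noteq> 0" using assms(3-5) by auto
  have c: "0 \<le> c" using assms(3) by (simp add: c_def)
  have \<tau>: "0 \<le> ?\<tau>"
    unfolding tau0_eq spectral_norm_def by (rule onorm_pos_le) simp
  note surj = J_surj[OF assms(2) nz(1,3) assms(6)]
  note pinv_le = norm_pinv_J_le[OF assms(2) nz(1,3) assms(6), where B = B]
  note Q_le = norm_quadratic_term_le[OF assms(2,3), of y, folded c_def]
  have \<rho>\<xi>: "?\<rho>\<xi> \<xi> = norm (pinv (?J \<xi>) *v h \<xi>)" for \<xi>
    by (simp add: rho_at_def h_def)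
  have in_S: "(E, f, F, g) \<in> ?S \<longleftrightarrow> (\<exists>\<xi>. ?J \<xi> *v ?w E f F g + ?Q (?w E f F g) = h \<xi>)" for E f F g
    unfolding h_def by (rule S_ILSE_iff[OF nz])
  have \<mu>: "?\<mu> = (INF (E, f, F, g) \<in> ?S. norm (?w E f F g))"
    unfolding mu_ILSE_def norm_perturbation_vec ..
  have bdd_\<rho>: "bdd_below (range ?\<rho>\<xi>)"
    by (rule bdd_belowI[of _ 0]) (auto simp: \<rho>\<xi>)
  have bdd_\<mu>: "bdd_below ((\<lambda>(E, f, F, g). norm (?w E f F g)) ` ?S)"
    by (rule bdd_belowI[of _ 0]) auto
  have \<rho>_nonneg: "0 \<le> ?\<rho>"
    unfolding rho_def by (rule cINF_greatest) (auto simp: \<rho>\<xi>)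

  have lower: "2 * ?\<rho> / (1 + sqrt 2) \<le> norm (?w E f F g)"
    if in_set: "(E, f, F, g) \<in> ?S" for E f F g
  proof (rule ccontr)
    let ?n = "norm (?w E f F g)"
    \<comment> \<open>s = 1 / (1 + sqrt 2) is the positive root of s^2 + 2 s = 1. A solution of norm
      below 2 s \<rho> would give \<rho>(\<xi>) < 2 s \<rho> + s^2 \<rho> = \<rho>, against the
      definition of \<rho> as an infimum.\<close>
    define s where "s = sqrt 2 - (1::real)"
    have s: "0 < s" "2 * s + s * s = 1" by (auto simp: s_def algebra_simps)
    have "s * (1 + sqrt 2) = 1" by (simp add: s_def algebra_simps)
    then have "s = 1 / (1 + sqrt 2)" by (subst eq_divide_eq) auto
    then have s_eq: "2 * ?\<rho> / (1 + sqrt 2) = 2 * s * ?\<rho>" by simp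
    assume "\<not> 2 * ?\<rho> / (1 + sqrt 2) \<le> ?n"
    then have n: "?n < 2 * s * ?\<rho>" using s_eq by simp
    then have "0 < 2 * s * ?\<rho>" by (rule le_less_trans[OF norm_ge_zero])
    then have "0 < ?\<rho>" using s(1) by (simp add: zero_less_mult_iff)
    obtain \<xi> where "?J \<xi> *v ?w E f F g + ?Q (?w E f F g) = h \<xi>" using in_set in_S by blast
    then have "pinv (?J \<xi>) *v h \<xi>
        = pinv (?J \<xi>) *v (?J \<xi> *v ?w E f F g) + pinv (?J \<xi>) *v ?Q (?w E f F g)"
      by (metis matrix_vector_right_distrib)
    then have "?\<rho>\<xi> \<xi>
        = norm (pinv (?J \<xi>) *v (?J \<xi> *v ?w E f F g) + pinv (?J \<xi>) *v ?Q (?w E f F g))"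
      unfolding \<rho>\<xi> by (rule arg_cong)
    also have "\<dots> \<le> ?n + ?\<tau> * norm (?Q (?w E f F g) :: real^('n + 's))"
      by (rule order_trans[OF norm_triangle_ineq add_mono[OF norm_pinv_mult_le pinv_le]])
    also have "\<dots> \<le> ?n + ?\<tau> * (c * ?n\<^sup>2)"
      by (intro add_left_mono mult_left_mono Q_le \<tau>)
    also have "\<dots> \<le> ?n + ?\<tau> * (c * (2 * s * ?\<rho>)\<^sup>2)"
      using n \<tau> c by (intro add_left_mono mult_left_mono power_mono) auto
    \<comment> \<open>The regrouping isolates the factor that the smallness hypothesis bounds by
      1.\<close>
    also have "\<dots> = ?n + (4 * ?\<tau> * ?\<rho> * c) * (s * s * ?\<rho>)"
      by (simp add: power2_eq_square)
    also have "\<dots> < 2 * s * ?\<rho> + 1 * (s * s * ?\<rho>)"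
      using n assms(7) s(1) \<open>0 < ?\<rho>\<close> by (intro add_strict_mono mult_strict_right_mono) (auto simp: c_def)
    also have "\<dots> = (2 * s + s * s) * ?\<rho>" by (simp only: ring_distribs mult_1)
    also have "\<dots> = ?\<rho>" using s(2) by simp
    finally have "?\<rho>\<xi> \<xi> < ?\<rho>" .
    moreover have "?\<rho> \<le> ?\<rho>\<xi> \<xi>" unfolding rho_def by (rule cINF_lower[OF bdd_\<rho>]) simp
    ultimately show False by simp
  qed

  have upper: "\<exists>E f F g. (E, f, F, g) \<in> ?S \<and> norm (?w E f F g) \<le> 2 * ?\<rho>\<xi> \<xi>"
    if "4 * ?\<tau> * c * ?\<rho>\<xi> \<xi> \<le> 1" for \<xi>
  proof -
    have small: "4 * ?\<tau> * c * norm (pinv (?J \<xi>) *v h \<xi>) \<le> 1" using that by (simp add: \<rho>\<xi>)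
    obtain w where w: "?J \<xi> *v w + ?Q w = h \<xi>" "norm w \<le> 2 * norm (pinv (?J \<xi>) *v h \<xi>)"
      by (rule quadratic_perturbation_solvable[OF surj pinv_le \<tau> Q_le c
            continuous_on_quadratic_term small])
    obtain E f F g where "w = ?w E f F g" using perturbation_vec_surj[OF nz] by metis
    then show ?thesis using w in_S unfolding \<rho>\<xi> by blast
  qed

  have \<mu>_le: "?\<mu> \<le> 2 * ?\<rho>\<xi> \<xi>" if small: "4 * ?\<tau> * c * ?\<rho>\<xi> \<xi> \<le> 1" for \<xi>
  proof -
    obtain E f F g where "(E, f, F, g) \<in> ?S" "norm (?w E f F g) \<le> 2 * ?\<rho>\<xi> \<xi>"
      using upper[OF small] by blast
    then show ?thesis
      unfolding \<mu> using cINF_lower[OF bdd_\<mu>, of "(E, f, F, g)"] by simp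
  qed

  \<comment> \<open>Attainment of the infimum \<rho> is not assumed. The strict hypothesis persists
    for x slightly above \<rho>; for such x some \<xi> has \<rho>(\<xi>) < x, whence \<mu> \<le> 2
    x, and x tends to \<rho> from the right.\<close>
  have ev: "\<forall>\<^sub>F x in at_right ?\<rho>. 4 * ?\<tau> * c * x < 1"
  proof (rule order_tendstoD(2))
    show "((\<lambda>x. 4 * ?\<tau> * c * x) \<longlongrightarrow> 4 * ?\<tau> * c * ?\<rho>) (at_right ?\<rho>)"
      by (intro tendsto_intros)
    show "4 * ?\<tau> * c * ?\<rho> < 1" using assms(7) by (simp add: c_def mult_ac)
  qed
  have near: "\<exists>\<xi>. ?\<rho>\<xi> \<xi> < x" if "?\<rho> < x" for x
    using that cINF_less_iff[OF UNIV_not_empty bdd_\<rho>, of x] unfolding rho_def by blast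
  have \<mu>_le_near: "?\<mu> \<le> 2 * x" if "?\<rho> < x" "4 * ?\<tau> * c * x < 1" for x
  proof -
    obtain \<xi> where \<xi>: "?\<rho>\<xi> \<xi> < x" using near \<open>?\<rho> < x\<close> by blast
    then have "4 * ?\<tau> * c * ?\<rho>\<xi> \<xi> \<le> 4 * ?\<tau> * c * x"
      using \<tau> c by (intro mult_left_mono) auto
    then show ?thesis using \<mu>_le[of \<xi>] \<xi> that(2) by simp
  qed
  have "?\<mu> \<le> 2 * ?\<rho>"
  proof (rule tendsto_lowerbound)
    show "((\<lambda>x. 2 * x) \<longlongrightarrow> 2 * ?\<rho>) (at_right ?\<rho>)" by (intro tendsto_intros)
    show "\<forall>\<^sub>F x in at_right ?\<rho>. ?\<mu> \<le> 2 * x"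
      using ev eventually_at_right_less[of ?\<rho>] by eventually_elim (rule \<mu>_le_near)
  qed simp
  moreover have "?S \<noteq> {}"
  proof -
    \<comment> \<open>With A + E = 0 and multiplier 0 the first equation is trivial, and g is chosen
      to satisfy the constraint. Nonemptiness is what allows a lower bound to pass to the real
      infimum.\<close>
    have "(- A, - b, 0, B *v y - d) \<in> ?S"
      unfolding S_ILSE_def mem_Collect_eq case_prod_conv by (intro exI[of _ 0]) simp
    then show ?thesis by blast
  qed
  then have "2 * ?\<rho> / (1 + sqrt 2) \<le> ?\<mu>"
    unfolding \<mu> by (rule cINF_greatest) (clarsimp simp: lower)
  ultimately show ?thesis by blast
qed

end
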